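(* Let $X$ be a separable real Banach space of dimension bigger than $1$. Then $\mathfrak{add}(X)=\omega_1$, $\mathfrak{non}(X)=\omega_1$, $\mathfrak{cov}(X)=\mathfrak{c}$ and $\mathfrak{cof}(X)=\mathfrak{c}$.
   Context: A hyperplane of a Banach space $X$ is a one-codimensional closed linear subspace of $X$. Let $\mathcal{H}_\sigma(X)$ be the family of all subsets of $X$ that can be covered by countably many hyperplanes of $X$. Then: $\mathfrak{add}(X)$ is the minimal cardinality of a family of sets from $\mathcal{H}_\sigma(X)$ whose union is not in $\mathcal{H}_\sigma(X)$; $\mathfrak{cov}(X)$ is the minimal cardinality of a family of sets from $\mathcal{H}_\sigma(X)$ whose union is $X$; $\mathfrak{non}(X)$ is the minimal cardinality of a subset of $X$ that is not in $\mathcal{H}_\sigma(X)$; $\mathfrak{cof}(X)$ is the minimal cardinality of a family of sets from $\mathcal{H}_\sigma(X)$ such that each member of $\mathcal{H}_\sigma(X)$ is contained in some element of that family. $\mathfrak{c}=|\mathbb{R}|$. *)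

theory Defs
  imports "HOL-Analysis.Analysis"
begin

no_notation elt_set_eq  (infix "=o" 50)
unbundle cardinal_syntax

text \<open>Codimension one: the quotient by \<open>H\<close> is spanned by the class of a single vector
  \<open>v\<close>, which is nonzero in the quotient.\<close>

definition hyperplane :: "'a::real_normed_vector set \<Rightarrow> bool" where
  "hyperplane H \<longleftrightarrow>
     subspace H \<and> closed H \<and> (\<exists>v. v \<notin> H \<and> span (insert v H) = UNIV)"

definition H_sigma :: "'a::real_normed_vector set set" where
  "H_sigma = {A. \<exists>\<C>. countable \<C> \<and> (\<forall>H\<in>\<C>. hyperplane H) \<and> A \<subseteq> \<Union>\<C>}"

text \<open>\<open>is_min_card P r\<close>: the minimal cardinality of a set satisfying \<open>P\<close> exists and
  equals the cardinal \<open>r\<close>. Cardinals are well-orders up to order isomorphism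
  and may live on different types, so equality with a cardinal is expressed by a relation
  rather than by a function.\<close>

definition is_min_card :: "('b set \<Rightarrow> bool) \<Rightarrow> 'c rel \<Rightarrow> bool" where
  "is_min_card P r \<longleftrightarrow> (\<exists>S. P S \<and> |S| =o r) \<and> (\<forall>S. P S \<longrightarrow> r \<le>o |S| )"

lemma is_min_card_unique:
  assumes "is_min_card P r" "is_min_card P s"
  shows "r =o s"
  using assms unfolding is_min_card_def
  by (meson ordIso_iff_ordLeq ordLeq_ordIso_trans)

definition is_add :: "'a set set \<Rightarrow> 'c rel \<Rightarrow> bool" where
  "is_add \<I> = is_min_card (\<lambda>\<F>. \<F> \<subseteq> \<I> \<and> \<Union>\<F> \<notin> \<I>)"

definition is_cov :: "'a set set \<Rightarrow> 'c rel \<Rightarrow> bool" where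
  "is_cov \<I> = is_min_card (\<lambda>\<F>. \<F> \<subseteq> \<I> \<and> \<Union>\<F> = UNIV)"

definition is_non :: "'a set set \<Rightarrow> 'c rel \<Rightarrow> bool" where
  "is_non \<I> = is_min_card (\<lambda>A. A \<notin> \<I>)"

definition is_cof :: "'a set set \<Rightarrow> 'c rel \<Rightarrow> bool" where
  "is_cof \<I> = is_min_card (\<lambda>\<F>. \<F> \<subseteq> \<I> \<and> (\<forall>A\<in>\<I>. \<exists>B\<in>\<F>. A \<subseteq> B))"

abbreviation omega1 :: "nat set rel" where
  "omega1 \<equiv> cardSuc natLeq"

abbreviation continuum :: "real rel" where
  "continuum \<equiv> |UNIV :: real set|"

end

theory Submission
  imports Defs "HOL-Complex_Analysis.Conformal_Mappings" "HOL-Library.Countable_Set_Type"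
begin

no_notation elt_set_eq  (infix "=o" 50)

text \<open>
  All four values follow from one object: a curve \<open>x\<close> on the open unit interval that meets every
  hyperplane for only countably many parameters (\<open>ex_overcomplete_curve\<close>). If \<open>d\<close> is a dense
  sequence with normalised terms \<open>sgn (d n)\<close>, put \<open>x t = (\<Sum>n. t ^ n *\<^sub>R sgn (d n))\<close>. A continuous
  functional \<open>f\<close> turns the curve into the power series with coefficients \<open>f (sgn (d n))\<close>. If
  \<open>f\<close> is nonzero, density makes one of these coefficients nonzero, and a nonzero analytic function
  has only countably many zeros. Consequently a member of \<open>H_sigma\<close> also meets the curve for
  countably many parameters only.

  \<^item> \<^emph>\<open>Uniformity and additivity.\<close> The image under \<open>x\<close> of a set of \<open>\<omega>\<^sub>1\<close> parameters is not in
    \<open>H_sigma\<close>, so its singletons form a family of \<open>\<omega>\<^sub>1\<close> small sets with a large union. Conversely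
    \<open>H_sigma\<close> is closed under countable unions and contains the singletons, hence all countable sets.

  \<^item> \<^emph>\<open>Lower bounds for covering and cofinality.\<close> A cover of the space by members of \<open>H_sigma\<close>
    splits the unit interval into countable pieces, one for each member, so it has at least
    continuum many members. A cofinal family is a cover because singletons are in \<open>H_sigma\<close>.

  \<^item> \<^emph>\<open>Upper bounds for covering and cofinality.\<close> The countable unions of hyperplanes are cofinal,
    hence also a cover. Each of them is a countable union of closed sets, and in a separable metric
    space there are at most continuum many of those (\<open>card_countable_unions_closed\<close>).

  Singletons lie in \<open>H_sigma\<close> because every point lies on some hyperplane. This is where dimension
  greater than one enters, and it needs a form of the Hahn-Banach theorem: every proper closed
  subspace is contained in a hyperplane (\<open>ex_hyperplane_superset\<close>).
\<close>

section \<open>Hyperplanes and continuous functionals\<close>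

text \<open>Writing \<open>x = h + f x *\<^sub>R v\<close> with \<open>h \<in> H\<close> defines the functional \<open>f\<close>. It is bounded because \<open>H\<close>
  is closed: if \<open>d\<close> bounds the distance from \<open>v\<close> to \<open>H\<close> from below, then
  \<open>d \<le> norm (v + (1 / f x) *\<^sub>R h)\<close>, and the right-hand side is \<open>norm x / \<bar>f x\<bar>\<close>.\<close>

lemma hyperplane_kernel:
  fixes H :: "'a::real_normed_vector set"
  assumes "hyperplane H"
  obtains f :: "'a \<Rightarrow> real" where "bounded_linear f" "H = {x. f x = 0}" "H \<noteq> UNIV"
proof -
  obtain v where sub: "subspace H" and cl: "closed H" and v: "v \<notin> H"
    and sp: "span (insert v H) = UNIV"
    using assms unfolding hyperplane_def by blast
  have "span H = H"
    using sub by (rule span_eq_iff[THEN iffD2])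
  then have "\<exists>c. x - c *\<^sub>R v \<in> H" for x
    using sp span_breakdown_eq[of x v H] by (metis UNIV_I)
  then obtain f where f: "\<And>x. x - f x *\<^sub>R v \<in> H"
    by metis
  have uniq: "f x = c" if "x - c *\<^sub>R v \<in> H" for x c
  proof (rule ccontr)
    assume ne: "f x \<noteq> c"
    have "(x - c *\<^sub>R v) - (x - f x *\<^sub>R v) \<in> H"
      using subspace_diff[OF sub that f] .
    then have "(f x - c) *\<^sub>R v \<in> H"
      by (simp add: algebra_simps)
    then have "inverse (f x - c) *\<^sub>R (f x - c) *\<^sub>R v \<in> H"
      using subspace_scale[OF sub] by blast
    with ne v show False
      by simp
  qed
  obtain d where d: "d > 0" and ball: "ball v d \<subseteq> - H"
    using cl v open_contains_ball[of "- H"] by (metis ComplI open_Compl)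
  have bound: "norm (f x) \<le> norm x * (1 / d)" for x
  proof (cases "f x = 0")
    case False
    have "(- inverse (f x)) *\<^sub>R (x - f x *\<^sub>R v) \<in> H"
      using subspace_scale[OF sub f] .
    then have "(- inverse (f x)) *\<^sub>R (x - f x *\<^sub>R v) \<notin> ball v d"
      using ball by blast
    moreover have "v - (- inverse (f x)) *\<^sub>R (x - f x *\<^sub>R v) = inverse (f x) *\<^sub>R x"
      using False by (simp add: algebra_simps)
    ultimately have "d \<le> norm (inverse (f x) *\<^sub>R x)"
      by (simp add: dist_norm)
    then show ?thesis
      using False d by (simp add: field_simps)
  qed (use d in simp)
  have "bounded_linear f"
  proof (rule bounded_linear_intro[OF _ _ bound])
    fix x y
    show "f (x + y) = f x + f y"
      using subspace_add[OF sub f[of x] f[of y]]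
      by (intro uniq) (simp add: algebra_simps)
  next
    fix r x
    show "f (r *\<^sub>R x) = r *\<^sub>R f x"
      using subspace_scale[OF sub f[of x], of r]
      by (intro uniq) (simp add: algebra_simps)
  qed
  moreover have "H = {x. f x = 0}"
    using uniq[of _ 0] f by (auto, metis diff_zero scale_zero_left)
  ultimately show thesis
    using that v by blast
qed

lemma subspace_closure:
  fixes S :: "'a::real_normed_vector set"
  assumes "subspace S"
  shows "subspace (closure S)"
  unfolding subspace_def
proof (intro conjI ballI allI)
  show "0 \<in> closure S"
    using subspace_0[OF assms] closure_subset by blast
next
  fix x y assume "x \<in> closure S" "y \<in> closure S"
  then obtain X Y where "\<And>n. X n \<in> S" "X \<longlonglongrightarrow> x" "\<And>n. Y n \<in> S" "Y \<longlonglongrightarrow> y"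
    unfolding closure_sequential by blast
  then have "\<forall>n. X n + Y n \<in> S" "(\<lambda>n. X n + Y n) \<longlonglongrightarrow> x + y"
    using subspace_add[OF assms] by (auto intro: tendsto_add)
  then show "x + y \<in> closure S"
    unfolding closure_sequential by (intro exI[of _ "\<lambda>n. X n + Y n"]) simp
next
  fix c :: real and x assume "x \<in> closure S"
  then obtain X where "\<And>n. X n \<in> S" "X \<longlonglongrightarrow> x"
    unfolding closure_sequential by blast
  then have "\<forall>n. c *\<^sub>R X n \<in> S" "(\<lambda>n. c *\<^sub>R X n) \<longlonglongrightarrow> c *\<^sub>R x"
    using subspace_scale[OF assms] by (auto intro: tendsto_scaleR)
  then show "c *\<^sub>R x \<in> closure S"
    unfolding closure_sequential by (intro exI[of _ "\<lambda>n. c *\<^sub>R X n"]) simp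
qed

text \<open>Mazur's geometric form of the Hahn-Banach theorem. By Zorn's lemma there is a subspace \<open>M \<supseteq> S\<close>
  that is maximal among the subspaces disjoint from a ball around a point \<open>v \<notin> S\<close>. It is closed,
  since its closure avoids the ball as well. If some \<open>w\<close> were outside the span of \<open>M\<close> and \<open>v\<close>, then
  for every real \<open>s\<close> maximality would force the span of \<open>M\<close> and \<open>w + s *\<^sub>R v\<close> to meet the ball.
  Whether it does so with a positive or a negative multiple of \<open>w + s *\<^sub>R v\<close> would divide the real
  line into two nonempty open sets, disjoint because the ball is convex; but the line is
  connected.\<close>

lemma ex_hyperplane_superset:
  fixes S :: "'a::real_normed_vector set"
  assumes "subspace S" "closed S" "S \<noteq> UNIV"
  shows "\<exists>H. hyperplane H \<and> S \<subseteq> H"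
proof -
  obtain v where v: "v \<notin> S"
    using assms by blast
  obtain d where d: "d > 0" and ball: "ball v d \<inter> S = {}"
    using assms(2) v open_contains_ball[of "- S"]
    by (metis ComplI disjoint_eq_subset_Compl open_Compl)
  define \<A> where "\<A> = {M. subspace M \<and> S \<subseteq> M \<and> ball v d \<inter> M = {}}"
  have "\<exists>M\<in>\<A>. \<forall>X\<in>\<A>. M \<subseteq> X \<longrightarrow> X = M"
  proof (rule subset_Zorn_nonempty)
    show "\<A> \<noteq> {}"
      using assms ball by (auto simp: \<A>_def)
  next
    fix \<C> assume ne: "\<C> \<noteq> {}" and ch: "subset.chain \<A> \<C>"
    have inA: "\<And>X. X \<in> \<C> \<Longrightarrow> X \<in> \<A>" and lin: "\<And>X Y. X \<in> \<C> \<Longrightarrow> Y \<in> \<C> \<Longrightarrow> X \<subseteq> Y \<or> Y \<subseteq> X"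
      using ch by (auto simp: subset_chain_def)
    have "subspace (\<Union>\<C>)"
      unfolding subspace_def
    proof (intro conjI ballI allI)
      show "0 \<in> \<Union>\<C>"
        using ne inA subspace_0 by (fastforce simp: \<A>_def)
    next
      fix x y assume "x \<in> \<Union>\<C>" "y \<in> \<Union>\<C>"
      then obtain X Y where "X \<in> \<C>" "x \<in> X" "Y \<in> \<C>" "y \<in> Y"
        by blast
      then obtain X where X: "X \<in> \<C>" "x \<in> X" "y \<in> X"
        using lin[of X Y] by blast
      then have "x + y \<in> X"
        using inA[OF X(1)] by (intro subspace_add) (auto simp: \<A>_def)
      with X(1) show "x + y \<in> \<Union>\<C>"
        by blast
    next
      fix c :: real and x assume "x \<in> \<Union>\<C>"
      then obtain X where X: "X \<in> \<C>" "x \<in> X"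
        by blast
      then have "c *\<^sub>R x \<in> X"
        using inA[OF X(1)] by (intro subspace_scale) (auto simp: \<A>_def)
      with X(1) show "c *\<^sub>R x \<in> \<Union>\<C>"
        by blast
    qed
    moreover have "S \<subseteq> \<Union>\<C>" "ball v d \<inter> \<Union>\<C> = {}"
      using ne inA by (auto simp: \<A>_def)
    ultimately show "\<Union>\<C> \<in> \<A>"
      by (simp add: \<A>_def)
  qed
  then obtain M where sub: "subspace M" and SM: "S \<subseteq> M" and dis: "ball v d \<inter> M = {}"
    and mx: "\<And>X. subspace X \<Longrightarrow> M \<subseteq> X \<Longrightarrow> ball v d \<inter> X = {} \<Longrightarrow> X = M"
    unfolding \<A>_def by (smt (verit) dual_order.trans mem_Collect_eq)
  have "closure M = M"
    using dis by (intro mx subspace_closure sub closure_subset)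
      (simp add: open_Int_closure_eq_empty)
  then have cl: "closed M"
    by (metis closed_closure)
  have vM: "v \<notin> M"
    using dis d by (metis centre_in_ball disjoint_iff)
  have span_M: "span M = M"
    using sub by (rule span_eq_iff[THEN iffD2])
  have "w \<in> span (insert v M)" for w
  proof (rule ccontr)
    assume w: "w \<notin> span (insert v M)"
    \<comment> \<open>The argument \<open>\<sigma> \<in> {1, - 1}\<close> is the sign of the multiple that enters the ball.\<close>
    define P where "P \<sigma> = {s. \<exists>c m. c > 0 \<and> m \<in> M \<and> m + (\<sigma> * c) *\<^sub>R (w + s *\<^sub>R v) \<in> ball v d}" for \<sigma> :: real
    have P_open: "open (P \<sigma>)" for \<sigma>
    proof -
      have P_eq: "P \<sigma> = (\<Union>c\<in>{0<..}. \<Union>m\<in>M. (\<lambda>s. m + (\<sigma> * c) *\<^sub>R (w + s *\<^sub>R v)) -` ball v d)"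
        unfolding P_def by blast
      have "open ((\<lambda>s. m + (\<sigma> * c) *\<^sub>R (w + s *\<^sub>R v)) -` ball v d)" for c m
        by (intro open_vimage open_ball continuous_intros)
      then show ?thesis
        unfolding P_eq by (intro open_UN ballI)
    qed
    have hit: "s \<in> P 1 \<union> P (- 1)" for s
    proof -
      let ?u = "w + s *\<^sub>R v"
      have "?u \<notin> M"
      proof
        assume "?u \<in> M"
        then have "?u - s *\<^sub>R v \<in> span (insert v M)"
          by (intro span_diff span_scale span_base) auto
        with w show False
          by simp
      qed
      then have "span (insert ?u M) \<noteq> M"
        by (metis insertI1 span_base)
      moreover have "M \<subseteq> span (insert ?u M)"
        using span_superset by blast
      ultimately have "ball v d \<inter> span (insert ?u M) \<noteq> {}"
        using mx[OF subspace_span] by blast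
      then obtain y where y: "y \<in> ball v d" "y \<in> span (insert ?u M)"
        by blast
      then obtain k where k: "y - k *\<^sub>R ?u \<in> M"
        using span_breakdown_eq[of y ?u M] span_M by metis
      have "k \<noteq> 0"
        using k y dis by auto
      then consider "k > 0" | "k < 0"
        by linarith
      then show ?thesis
      proof cases
        case 1
        with k y have "s \<in> P 1"
          unfolding P_def by (intro CollectI exI[of _ k] exI[of _ "y - k *\<^sub>R ?u"]) auto
        then show ?thesis ..
      next
        case 2
        with k y have "s \<in> P (- 1)"
          unfolding P_def by (intro CollectI exI[of _ "- k"] exI[of _ "y - k *\<^sub>R ?u"]) auto
        then show ?thesis ..
      qed
    qed
    have disj: "P 1 \<inter> P (- 1) = {}"
    proof (rule ccontr)
      assume "P 1 \<inter> P (- 1) \<noteq> {}"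
      then obtain s a b m n where a: "a > 0" "m \<in> M" "m + a *\<^sub>R (w + s *\<^sub>R v) \<in> ball v d"
        and b: "b > 0" "n \<in> M" "n - b *\<^sub>R (w + s *\<^sub>R v) \<in> ball v d"
        by (auto simp: P_def simp del: mem_ball)
      let ?u = "w + s *\<^sub>R v"
      \<comment> \<open>These weights cancel the multiples of \<open>w + s *\<^sub>R v\<close>, which leaves a point of \<open>M\<close> in the ball.\<close>
      define p q where "p = b / (a + b)" and "q = a / (a + b)"
      have pq: "p \<ge> 0" "q \<ge> 0" "p + q = 1" "p * a = q * b"
        using a(1) b(1) by (auto simp: p_def q_def simp flip: add_divide_distrib)
      have "p *\<^sub>R (m + a *\<^sub>R ?u) + q *\<^sub>R (n - b *\<^sub>R ?u) \<in> ball v d"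
        using a(3) b(3) pq by (intro convexD[OF convex_ball])
      moreover have "p *\<^sub>R (m + a *\<^sub>R ?u) + q *\<^sub>R (n - b *\<^sub>R ?u) = p *\<^sub>R m + q *\<^sub>R n"
        by (simp only: scaleR_add_right[of p m] scaleR_diff_right[of q n] scaleR_scaleR pq(4)) simp
      moreover have "p *\<^sub>R m + q *\<^sub>R n \<in> M"
        using a(2) b(2) by (intro subspace_add subspace_scale sub)
      ultimately show False
        using dis by auto
    qed
    \<comment> \<open>For \<open>k\<close> this large, \<open>v + (1 / k) *\<^sub>R w\<close> and \<open>v - (1 / k) *\<^sub>R w\<close> are both in the ball,
      so neither set is empty.\<close>
    define k where "k = norm w / d + 1"
    have k: "k > 0"
      using d by (simp add: k_def add_nonneg_pos)
    have "d * k = norm w + d"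
      using d by (simp add: k_def distrib_left)
    then have wk: "norm w / k < d"
      using d k by (simp add: pos_divide_less_eq)
    have "0 + (1 * (1 / k)) *\<^sub>R (w + k *\<^sub>R v) = v + (1 / k) *\<^sub>R w"
        "0 + (- 1 * (1 / k)) *\<^sub>R (w + (- k) *\<^sub>R v) = v - (1 / k) *\<^sub>R w"
      using k by (simp_all add: algebra_simps)
    then have "0 + (1 * (1 / k)) *\<^sub>R (w + k *\<^sub>R v) \<in> ball v d"
        "0 + (- 1 * (1 / k)) *\<^sub>R (w + (- k) *\<^sub>R v) \<in> ball v d"
      using wk k by (simp_all add: dist_norm)
    then have "k \<in> P 1" "- k \<in> P (- 1)"
      unfolding P_def mem_Collect_eq using k subspace_0[OF sub] by (meson divide_pos_pos zero_less_one)+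
    moreover have "connected (UNIV :: real set)"
      by (rule connected_UNIV)
    ultimately show False
      using P_open hit disj unfolding connected_def
      by (metis (no_types, lifting) Int_UNIV_right UNIV_I disjoint_iff subsetI)
  qed
  then have "hyperplane M"
    using sub cl vM unfolding hyperplane_def by blast
  with SM show ?thesis
    by blast
qed

lemma closed_span_singleton:
  fixes x :: "'a::real_normed_vector"
  shows "closed (span {x})"
proof -
  have "complete (range (\<lambda>c. c *\<^sub>R x))"
  proof (cases "x = 0")
    case False
    then show ?thesis
      by (intro complete_isometric_image[where e = "norm x"])
         (auto intro: bounded_linear_scaleR_left simp: complete_UNIV)
  qed (simp add: compact_imp_complete)
  then show ?thesis
    by (simp add: span_singleton complete_imp_closed)
qed

lemma point_in_hyperplane:
  fixes x :: "'a::real_normed_vector"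
  assumes "\<exists>B :: 'a set. independent B \<and> span B = UNIV \<and> (infinite B \<or> card B > 1)"
  shows "\<exists>H. hyperplane H \<and> x \<in> H"
proof -
  obtain B :: "'a set" where B: "independent B" "infinite B \<or> card B > 1"
    using assms by blast
  have "span {x} \<noteq> UNIV"
  proof
    assume "span {x} = UNIV"
    then have "finite B \<and> card B \<le> card {x}"
      using B by (intro independent_span_bound) auto
    with B show False
      by auto
  qed
  then show ?thesis
    using ex_hyperplane_superset[OF subspace_span closed_span_singleton] span_base
    by (metis insertI1 subsetD)
qed

section \<open>A curve meeting every hyperplane in a countable set\<close>

text \<open>Bounded coefficients make the series converge on the complex unit disc, where the zeros of a
  nonconstant holomorphic function are isolated and hence countable in number. A constant sum is the
  one case left: its value is nonzero because the coefficients do not all vanish.\<close>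

lemma countable_zeros_real_power_series:
  fixes a :: "nat \<Rightarrow> real"
  assumes bd: "\<And>n. \<bar>a n\<bar> \<le> 1" and m: "a m \<noteq> 0"
  shows "countable {t \<in> {0<..<1}. (\<lambda>n. a n * t ^ n) sums 0}"
proof -
  define g where "g z = (\<Sum>n. complex_of_real (a n) * z ^ n)" for z
  have sm: "(\<lambda>n. complex_of_real (a n) * z ^ n) sums g z" if "norm z < 1" for z
    unfolding g_def
  proof (rule summable_sums, rule summable_comparison_test', rule summable_geometric)
    show "norm (norm z) < 1"
      using that by simp
    show "norm (complex_of_real (a n) * z ^ n) \<le> norm z ^ n" for n
      using bd[of n] by (simp add: norm_mult norm_power mult_left_le_one_le)
  qed
  have hol: "g holomorphic_on ball 0 1"
    using sm by (intro power_series_holomorphic[where a = "\<lambda>n. complex_of_real (a n)"]) auto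
  have "countable {z \<in> ball 0 1. g z = 0}"
  proof (cases "g constant_on ball 0 1")
    case False
    have "fsigma (ball (0 :: complex) 1)"
      unfolding fsigma_Union_compact
      using open_Union_compact_subsets[OF open_ball, of "0 :: complex" 1]
      by (metis image_subsetI mem_Collect_eq)
    with False show ?thesis
      using hol by (intro holomorphic_countable_zeros) auto
  next
    case True
    then obtain c where c: "\<And>z. z \<in> ball 0 1 \<Longrightarrow> g z = c"
      unfolding constant_on_def by blast
    have "c \<noteq> 0"
    proof
      assume "c = 0"
      then have g0: "g 0 = 0"
        using c[of 0] by simp
      then have "m > 0"
        using m by (cases m) (auto simp: g_def)
      then obtain s where s: "s > 0" "\<And>z. z \<in> cball 0 s - {0} \<Longrightarrow> g z \<noteq> 0"
        using powser_0_nonzero[of 1 0 "\<lambda>n. complex_of_real (a n)" g m] sm g0 m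
        by auto
      have "g (of_real (min s (1 / 2))) = 0"
        using s(1) c[of "of_real (min s (1 / 2))"] \<open>c = 0\<close> by simp
      then show False
        using s(1) s(2)[of "of_real (min s (1 / 2))"] by simp
    qed
    then have "{z \<in> ball 0 1. g z = 0} = {}"
      using c by auto
    then show ?thesis
      by (simp only: countable_empty)
  qed
  moreover have "of_real ` {t \<in> {0<..<1}. (\<lambda>n. a n * t ^ n) sums 0} \<subseteq> {z \<in> ball 0 1. g z = 0}"
  proof clarify
    fix t :: real assume t: "t \<in> {0<..<1}" and s: "(\<lambda>n. a n * t ^ n) sums 0"
    have "(\<lambda>n. complex_of_real (a n) * of_real t ^ n) sums 0"
      using sums_of_real[OF s, where 'a = complex] by simp
    moreover have "norm (complex_of_real t) < 1"
      using t by simp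
    ultimately show "complex_of_real t \<in> ball 0 1 \<and> g (complex_of_real t) = 0"
      using sm sums_unique2 by fastforce
  qed
  ultimately have "countable (complex_of_real ` {t \<in> {0<..<1}. (\<lambda>n. a n * t ^ n) sums 0})"
    by (rule countable_subset[rotated])
  then show ?thesis
    by (rule countable_image_inj_on) (simp add: inj_on_def)
qed

lemma separable_dense_sequence:
  assumes "separable_space (euclidean :: 'a::topological_space topology)"
  obtains d :: "nat \<Rightarrow> 'a::topological_space" where "closure (range d) = UNIV"
proof -
  obtain D :: "'a set" where D: "countable D" "closure D = UNIV"
    using assms unfolding separable_space_def by auto
  then have "D \<noteq> {}"
    by auto
  with D show thesis
    using that[of "from_nat_into D"] by simp
qed

text \<open>Replacing \<open>d n\<close> by \<open>sgn (d n)\<close> makes the series converge absolutely for \<open>t < 1\<close> without changing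
  which functionals vanish on the whole sequence.\<close>

lemma ex_overcomplete_curve:
  assumes "separable_space (euclidean :: 'a::banach topology)"
  obtains x :: "real \<Rightarrow> 'a::banach" where "\<And>H. hyperplane H \<Longrightarrow> countable {t \<in> {0<..<1}. x t \<in> H}"
proof -
  obtain d :: "nat \<Rightarrow> 'a" where d: "closure (range d) = UNIV"
    using separable_dense_sequence[OF assms] .
  define x where "x t = (\<Sum>n. t ^ n *\<^sub>R sgn (d n))" for t :: real
  show thesis
  proof
    fix H :: "'a set" assume "hyperplane H"
    then have cl: "closed H"
      by (simp add: hyperplane_def)
    obtain f :: "'a \<Rightarrow> real"
      where f: "bounded_linear f" and H: "H = {x. f x = 0}" "H \<noteq> UNIV"
      using hyperplane_kernel[OF \<open>hyperplane H\<close>] by blast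
    interpret bounded_linear f
      by (rule f)
    have "\<not> range d \<subseteq> H"
      using d H(2) cl closure_minimal[of "range d" H] by auto
    then obtain m where m: "f (d m) \<noteq> 0"
      using H(1) by blast
    then have fm: "f (sgn (d m)) \<noteq> 0"
      by (auto simp: sgn_div_norm scaleR)
    obtain K where K: "K > 0" "\<And>y. norm (f y) \<le> norm y * K"
      using pos_bounded by blast
    have x_sums: "(\<lambda>n. f (sgn (d n)) * t ^ n) sums f (x t)" if "t \<in> {0<..<1}" for t
    proof -
      have "(\<lambda>n. t ^ n *\<^sub>R sgn (d n)) sums x t"
        unfolding x_def
      proof (rule summable_sums, rule summable_comparison_test', rule summable_geometric)
        show "norm t < 1"
          using that by simp
        show "norm (t ^ n *\<^sub>R sgn (d n)) \<le> t ^ n" for n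
          using that by (auto simp: norm_sgn)
      qed
      from sums[OF this] show ?thesis
        by (simp add: scaleR mult.commute)
    qed
    \<comment> \<open>Division by a bound \<open>K\<close> for \<open>f\<close> brings the coefficients into the unit interval.\<close>
    have "countable {t \<in> {0<..<1}. (\<lambda>n. (f (sgn (d n)) / K) * t ^ n) sums 0}"
    proof (rule countable_zeros_real_power_series)
      show "\<bar>f (sgn (d n)) / K\<bar> \<le> 1" for n
      proof -
        have "\<bar>f (sgn (d n))\<bar> \<le> norm (sgn (d n)) * K"
          using K(2)[of "sgn (d n)"] by simp
        also have "\<dots> \<le> K"
          using K(1) by (simp add: norm_sgn)
        finally show ?thesis
          using K(1) by simp
      qed
      show "f (sgn (d m)) / K \<noteq> 0"
        using fm K(1) by simp
    qed
    moreover have "{t \<in> {0<..<1}. x t \<in> H}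
        \<subseteq> {t \<in> {0<..<1}. (\<lambda>n. (f (sgn (d n)) / K) * t ^ n) sums 0}"
    proof clarify
      fix t :: real assume t: "t \<in> {0<..<1}" "x t \<in> H"
      then have "(\<lambda>n. f (sgn (d n)) * t ^ n) sums 0"
        using x_sums[OF t(1)] H(1) by simp
      from sums_divide[OF this, of K]
      show "(\<lambda>n. (f (sgn (d n)) / K) * t ^ n) sums 0"
        by simp
    qed
    ultimately show "countable {t \<in> {0<..<1}. x t \<in> H}"
      by (rule countable_subset[rotated])
  qed
qed

section \<open>The sigma-ideal generated by hyperplanes\<close>

lemma countable_curve_H_sigma:
  assumes x: "\<And>H. hyperplane H \<Longrightarrow> countable {t \<in> T. x t \<in> H}"
    and A: "A \<in> H_sigma"
  shows "countable {t \<in> T. x t \<in> A}"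
proof -
  obtain \<C> where \<C>: "countable \<C>" "\<forall>H\<in>\<C>. hyperplane H" "A \<subseteq> \<Union>\<C>"
    using A unfolding H_sigma_def by auto
  have "countable (\<Union>H\<in>\<C>. {t \<in> T. x t \<in> H})"
    using \<C> x by (intro countable_UN) auto
  then show ?thesis
    by (rule countable_subset[rotated]) (use \<C> in auto)
qed

lemma H_sigma_Union:
  assumes "countable \<F>" "\<F> \<subseteq> H_sigma"
  shows "\<Union>\<F> \<in> H_sigma"
proof -
  have "\<forall>A\<in>\<F>. \<exists>\<C>. countable \<C> \<and> (\<forall>H\<in>\<C>. hyperplane H) \<and> A \<subseteq> \<Union>\<C>"
    using assms(2) unfolding H_sigma_def by auto
  then obtain c where c: "\<And>A. A \<in> \<F> \<Longrightarrow> countable (c A)"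
      "\<And>A H. A \<in> \<F> \<Longrightarrow> H \<in> c A \<Longrightarrow> hyperplane H" "\<And>A. A \<in> \<F> \<Longrightarrow> A \<subseteq> \<Union>(c A)"
    by metis
  have "countable (\<Union>(c ` \<F>))"
    using assms(1) c(1) by auto
  moreover have "\<Union>\<F> \<subseteq> \<Union>(\<Union>(c ` \<F>))"
    using c(3) by blast
  ultimately show ?thesis
    unfolding H_sigma_def using c(2) by (intro CollectI exI[of _ "\<Union>(c ` \<F>)"]) auto
qed

text \<open>The complement of \<open>C\<close> is a union of balls from a countable base, so \<open>C\<close> is determined by
  a set \<open>E\<close> of pairs of natural numbers, the indices of the balls that avoid it.\<close>

lemma closed_sets_coding:
  fixes d :: "nat \<Rightarrow> 'a::metric_space"
  assumes d: "closure (range d) = UNIV" and C: "closed C"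
  shows "\<exists>E. C = {x. \<forall>(i, k)\<in>E. x \<notin> ball (d i) (inverse (Suc k))}"
proof -
  define E where "E = {(i, k). ball (d i) (inverse (Suc k)) \<inter> C = {}}"
  have "\<exists>(i, k)\<in>E. x \<in> ball (d i) (inverse (Suc k))" if x: "x \<notin> C" for x
  proof -
    obtain e where e: "e > 0" "ball x e \<subseteq> - C"
      using C x open_contains_ball[of "- C"] by (metis ComplI open_Compl)
    obtain k where k: "inverse (real (Suc k)) < e / 2"
      using reals_Archimedean[of "e / 2"] e(1) by auto
    have "x \<in> closure (range d)"
      using d by simp
    then obtain i where i: "dist (d i) x < inverse (real (Suc k))"
      unfolding closure_approachable
      by (metis (no_types, lifting) imageE inverse_positive_iff_positive of_nat_0_less_iff zero_less_Suc)
    have "ball (d i) (inverse (Suc k)) \<subseteq> ball x e"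
    proof
      fix y assume "y \<in> ball (d i) (inverse (Suc k))"
      then have "dist (d i) y < e / 2"
        using k by simp
      moreover have "dist x (d i) < e / 2"
        using i k by (simp add: dist_commute)
      ultimately have "dist x y < e"
        using dist_triangle_half_r[of x "d i" e y] dist_triangle[of x y "d i"] by simp
      then show "y \<in> ball x e"
        by simp
    qed
    then have "(i, k) \<in> E"
      using e(2) by (auto simp: E_def)
    then show ?thesis
      using i by auto
  qed
  moreover have "x \<notin> ball (d i) (inverse (Suc k))" if "x \<in> C" "(i, k) \<in> E" for x i k
    using that by (auto simp: E_def)
  ultimately have "C = {x. \<forall>(i, k)\<in>E. x \<notin> ball (d i) (inverse (Suc k))}"
    by blast
  then show ?thesis ..
qed

lemma card_nat_sets: "|UNIV :: nat set set| =o continuum"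
  using nat_sets_eqpoll_reals by (simp add: eqpoll_iff_card_of_ordIso)

text \<open>A sequence of closed sets is coded by a sequence of sets of pairs, hence by one set of triples of
  natural numbers, hence by one set of natural numbers; there are continuum many of these.\<close>

lemma card_countable_unions_closed:
  assumes sep: "separable_space (euclidean :: 'a::metric_space topology)"
  shows "|{\<Union>\<C> | \<C> :: 'a::metric_space set set. countable \<C> \<and> (\<forall>C\<in>\<C>. closed C)}| \<le>o continuum"
proof -
  obtain d :: "nat \<Rightarrow> 'a" where d: "closure (range d) = UNIV"
    using separable_dense_sequence[OF sep] .
  define dec :: "nat set \<Rightarrow> 'a set"
    where "dec G = {x. \<exists>n::nat. \<forall>i k. to_nat (n, i, k) \<in> G \<longrightarrow> x \<notin> ball (d i) (inverse (Suc k))}"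
    for G
  have "{\<Union>\<C> | \<C> :: 'a set set. countable \<C> \<and> (\<forall>C\<in>\<C>. closed C)} \<subseteq> range dec"
  proof clarify
    fix \<C> :: "'a set set" assume \<C>: "countable \<C>" "\<forall>C\<in>\<C>. closed C"
    \<comment> \<open>The empty set is added so that an empty family can be enumerated too.\<close>
    define c where "c = from_nat_into (insert {} \<C>)"
    have range_c: "range c = insert {} \<C>"
      using \<C>(1) unfolding c_def by (intro range_from_nat_into) auto
    have "closed (c n)" for n
      using \<C>(2) range_c by (metis closed_empty insert_iff rangeI)
    then have "\<forall>n. \<exists>E. c n = {x. \<forall>(i, k)\<in>E. x \<notin> ball (d i) (inverse (Suc k))}"
      using closed_sets_coding[OF d] by blast
    from choice[OF this]
    obtain E where E: "\<And>n. c n = {x. \<forall>(i, k)\<in>E n. x \<notin> ball (d i) (inverse (Suc k))}"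
      by blast
    have code: "to_nat (n, i, k) \<in> to_nat ` {(n, i, k). (i, k) \<in> E n} \<longleftrightarrow> (i, k) \<in> E n" for n i k :: nat
      using inj_image_mem_iff[OF inj_to_nat, of "(n, i, k)" "{(n, i, k). (i, k) \<in> E n}"]
      by simp
    have "\<Union>\<C> = (\<Union>n. c n)"
      using range_c by auto
    also have "\<dots> = dec (to_nat ` {(n, i, k). (i, k) \<in> E n})"
      unfolding dec_def E code by (simp add: set_eq_iff Ball_def del: mem_ball)
    finally show "\<Union>\<C> \<in> range dec"
      by blast
  qed
  then have "|{\<Union>\<C> | \<C> :: 'a set set. countable \<C> \<and> (\<forall>C\<in>\<C>. closed C)}| \<le>o |range dec|"
    by (rule card_of_mono1)
  also have "|range dec| \<le>o |UNIV :: nat set set|"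
    by (rule card_of_image)
  also have "|UNIV :: nat set set| =o continuum"
    by (rule card_nat_sets)
  finally show ?thesis .
qed

section \<open>Cardinal arithmetic\<close>

lemma omega1_ordLeq_iff_uncountable: "omega1 \<le>o |A| \<longleftrightarrow> uncountable A"
proof -
  have "omega1 \<le>o |A| \<longleftrightarrow> natLeq <o |A|"
    using cardSuc_ordLess_ordLeq[OF natLeq_Card_order card_of_Card_order] by blast
  also have "\<dots> \<longleftrightarrow> uncountable A"
    unfolding countable_card_le_natLeq
    using not_ordLeq_iff_ordLess[OF natLeq_Well_order card_of_Well_order] by blast
  finally show ?thesis .
qed

lemma ex_subset_card_omega1:
  assumes "uncountable A"
  obtains T where "T \<subseteq> A" "|T| =o omega1"
proof -
  have F: "|Field omega1| =o omega1"
    by (intro card_of_Field_ordIso cardSuc_Card_order natLeq_Card_order)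
  then have "|Field omega1| \<le>o |A|"
    using assms omega1_ordLeq_iff_uncountable ordIso_ordLeq_trans by blast
  then obtain f where f: "inj_on f (Field omega1)" "f ` Field omega1 \<subseteq> A"
    unfolding card_of_ordLeq[symmetric] by blast
  have "|f ` Field omega1| =o |Field omega1|"
    using f(1) card_of_ordIsoI[of f "Field omega1"] ordIso_symmetric
    by (metis inj_on_imp_bij_betw)
  then show thesis
    using that[OF f(2)] F ordIso_transitive by blast
qed

text \<open>The family is infinite since \<open>I\<close> is uncountable, so countable pieces are no larger than
  \<open>\<F>\<close>, and a union of \<open>|\<F>|\<close> many sets of size at most \<open>|\<F>|\<close> again has size at most \<open>|\<F>|\<close>.\<close>

lemma card_le_of_countable_pieces:
  assumes "uncountable I" "I \<subseteq> (\<Union>A\<in>\<F>. P A)" "\<And>A. A \<in> \<F> \<Longrightarrow> countable (P A)"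
  shows "|I| \<le>o |\<F>|"
proof -
  have inf: "infinite \<F>"
    using assms by (metis countable_UN countable_finite countable_subset)
  have "|P A| \<le>o |\<F>|" if "A \<in> \<F>" for A
  proof -
    have "|P A| \<le>o natLeq"
      using assms(3)[OF that] countable_card_le_natLeq by blast
    also have "natLeq \<le>o |\<F>|"
      using inf infinite_iff_natLeq_ordLeq by blast
    finally show ?thesis .
  qed
  then have "|\<Union>A\<in>\<F>. P A| \<le>o |\<F>|"
    by (intro card_of_UNION_ordLeq_infinite[OF inf ordIso_imp_ordLeq[OF card_of_refl]] ballI)
  then show ?thesis
    using card_of_mono1[OF assms(2)] ordLeq_transitive by blast
qed

section \<open>The four cardinal invariants\<close>

theorem theorem1:
  assumes separable: "separable_space (euclidean :: 'a::banach topology)"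
    and dim_gt_1: "\<exists>B :: 'a set. independent B \<and> span B = UNIV \<and> (infinite B \<or> card B > 1)"
  shows "is_add (H_sigma :: 'a set set) omega1 \<and>
         is_non (H_sigma :: 'a set set) omega1 \<and>
         is_cov (H_sigma :: 'a set set) continuum \<and>
         is_cof (H_sigma :: 'a set set) continuum"
proof -
  let ?I = "{0<..<1 :: real}"
  obtain x :: "real \<Rightarrow> 'a" where x: "\<And>H. hyperplane H \<Longrightarrow> countable {t \<in> ?I. x t \<in> H}"
    using ex_overcomplete_curve[OF separable] by blast
  have xA: "countable {t \<in> ?I. x t \<in> A}" if "A \<in> H_sigma" for A
    using countable_curve_H_sigma[OF x that] .
  have unc: "uncountable ?I"
    by (simp add: uncountable_open_interval)
  have card_I: "|?I| =o continuum"
    using eqpoll_real_subset[of 0 1 ?I] by (simp add: eqpoll_iff_card_of_ordIso)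

  have sing: "{y} \<in> H_sigma" for y :: 'a
  proof -
    obtain H where "hyperplane H" "y \<in> H"
      using point_in_hyperplane[OF dim_gt_1] by blast
    then show ?thesis
      unfolding H_sigma_def by (intro CollectI exI[of _ "{H}"]) auto
  qed
  have countable_small: "A \<in> H_sigma" if "countable A" for A :: "'a set"
    using H_sigma_Union[of "(\<lambda>y. {y}) ` A"] that sing by auto

  obtain T where T: "T \<subseteq> ?I" "|T| =o omega1"
    using ex_subset_card_omega1[OF unc] .
  have uncT: "uncountable T"
    using T(2) omega1_ordLeq_iff_uncountable ordIso_iff_ordLeq by blast
  have S: "x ` T \<notin> H_sigma"
  proof
    assume "x ` T \<in> H_sigma"
    then have "countable T"
      using T(1) by (intro countable_subset[OF _ xA]) auto
    with uncT show False ..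
  qed
  have "|x ` T| \<le>o omega1"
    using card_of_image[of x T] T(2) ordLeq_ordIso_trans by blast
  moreover have "omega1 \<le>o |x ` T|"
    using S countable_small omega1_ordLeq_iff_uncountable by blast
  ultimately have card_S: "|x ` T| =o omega1"
    by (simp add: ordIso_iff_ordLeq)

  have non: "is_non (H_sigma :: 'a set set) omega1"
    unfolding is_non_def is_min_card_def
    using S card_S countable_small omega1_ordLeq_iff_uncountable by blast

  have add: "is_add (H_sigma :: 'a set set) omega1"
    unfolding is_add_def is_min_card_def
  proof (intro conjI allI impI)
    let ?\<F> = "(\<lambda>y. {y}) ` x ` T"
    have "|?\<F>| =o |x ` T|"
      by (intro ordIso_symmetric[OF card_of_ordIsoI[of "\<lambda>y. {y}"]] bij_betw_imageI) auto
    then have "|?\<F>| =o omega1"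
      using card_S ordIso_transitive by blast
    then show "\<exists>\<F> :: 'a set set. (\<F> \<subseteq> H_sigma \<and> \<Union>\<F> \<notin> H_sigma) \<and> |\<F>| =o omega1"
      using sing S by (intro exI[of _ ?\<F>]) auto
  next
    fix \<F> :: "'a set set" assume "\<F> \<subseteq> H_sigma \<and> \<Union>\<F> \<notin> H_sigma"
    then show "omega1 \<le>o |\<F>|"
      using H_sigma_Union omega1_ordLeq_iff_uncountable by blast
  qed

  have cov_lower: "continuum \<le>o |\<F>|" if "\<F> \<subseteq> H_sigma" "\<Union>\<F> = UNIV" for \<F> :: "'a set set"
  proof -
    have "?I \<subseteq> (\<Union>A\<in>\<F>. {t \<in> ?I. x t \<in> A})"
      using that(2) by (auto simp: set_eq_iff)
    then have "|?I| \<le>o |\<F>|"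
      using that(1) xA by (intro card_le_of_countable_pieces[OF unc]) auto
    then show ?thesis
      using card_I ordIso_ordLeq_trans ordIso_symmetric by blast
  qed
  have cofinal_covers: "\<Union>\<F> = UNIV" if "\<forall>A\<in>H_sigma. \<exists>B\<in>\<F>. A \<subseteq> B" for \<F> :: "'a set set"
    using that sing by blast

  define \<B> :: "'a set set" where "\<B> = {\<Union>\<C> | \<C>. countable \<C> \<and> (\<forall>H\<in>\<C>. hyperplane H)}"
  have \<B>: "\<B> \<subseteq> H_sigma" "\<forall>A\<in>H_sigma. \<exists>B\<in>\<B>. A \<subseteq> B"
    unfolding \<B>_def H_sigma_def by auto
  have "\<B> \<subseteq> {\<Union>\<C> | \<C>. countable \<C> \<and> (\<forall>C\<in>\<C>. closed C)}"
    unfolding \<B>_def hyperplane_def by blast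
  then have "|\<B>| \<le>o continuum"
    by (rule ordLeq_transitive[OF card_of_mono1 card_countable_unions_closed[OF separable]])
  then have card_\<B>: "|\<B>| =o continuum"
    using cov_lower[OF \<B>(1) cofinal_covers[OF \<B>(2)]] by (simp add: ordIso_iff_ordLeq)

  have cov: "is_cov (H_sigma :: 'a set set) continuum"
    unfolding is_cov_def is_min_card_def
    using \<B>(1) cofinal_covers[OF \<B>(2)] card_\<B> cov_lower
    by (intro conjI exI[of _ \<B>] allI impI) simp_all
  have cof: "is_cof (H_sigma :: 'a set set) continuum"
    unfolding is_cof_def is_min_card_def
    using \<B> card_\<B> cov_lower cofinal_covers
    by (intro conjI exI[of _ \<B>] allI impI) simp_all
  show ?thesis
    using add non cov cof by blast
qed

end
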